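(* Let $\mathbf{T}=(\mathbf{T}(N))_{N\ge 0}$ be defined by $\mathbf{T}(N)=s_{3/2}(N) \bmod 2$, where $s_{3/2}(N)$ is the sum of the digits of the base $3/2$ representation of $N$. Then $\mathbf{T}$ is a fixed point of the $2$-$3$-block substitution $\kappa$ on $\{0,1\}$ given by $$00\mapsto 010,\quad 01\mapsto 010,\quad 10\mapsto 101,\quad 11\mapsto 101,$$ i.e., $\kappa(\mathbf{T})=\mathbf{T}$.
   Context: Every natural number $N$ can be written uniquely (ignoring leading zeros) as $N=\sum_{i=0}^{R} d_i (3/2)^i$ with digits $d_i\in\{0,1,2\}$; this is the base $3/2$ representation of $N$, and $s_{3/2}(N)=\sum_{i=0}^R d_i$ (with $s_{3/2}(0)=0$). A $2$-$3$-block substitution $\kappa$ on an alphabet $A$ assigns to each word $ab$ of length 2 over $A$ a word $\kappa(ab)$ of length 3; it acts on an infinite sequence $x=x_0x_1x_2\dots$ by $\kappa(x)=y$ where $y_{3k}y_{3k+1}y_{3k+2}=\kappa(x_{2k}x_{2k+1})$ for $k=0,1,2,\dots$. A fixed point of $\kappa$ is a sequence $x$ with $\kappa(x)=x$. *)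

theory Defs
  imports Complex_Main
begin

(* Digit lists are little-endian: ds ! i is the coefficient of (3/2)^i.  Leading zeros are
   excluded by the condition on the last element, so 0 is represented by the empty list. *)
definition is_base32_rep :: "nat list \<Rightarrow> nat \<Rightarrow> bool" where
  "is_base32_rep ds N \<longleftrightarrow>
     set ds \<subseteq> {0, 1, 2} \<and> (ds \<noteq> [] \<longrightarrow> last ds \<noteq> 0) \<and>
     (of_nat N :: rat) = (\<Sum>i<length ds. of_nat (ds ! i) * (3 / 2) ^ i)"

definition base32_rep :: "nat \<Rightarrow> nat list" where
  "base32_rep N = (THE ds. is_base32_rep ds N)"

definition s32 :: "nat \<Rightarrow> nat" where
  "s32 N = sum_list (base32_rep N)"

definition T :: "nat \<Rightarrow> nat" where
  "T N = s32 N mod 2"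

definition is_block_subst_2_3 :: "'a set \<Rightarrow> ('a list \<Rightarrow> 'a list) \<Rightarrow> bool" where
  "is_block_subst_2_3 A \<kappa> \<longleftrightarrow>
     (\<forall>w. length w = 2 \<and> set w \<subseteq> A \<longrightarrow> length (\<kappa> w) = 3 \<and> set (\<kappa> w) \<subseteq> A)"

(* The letter at position n = 3 * k + j (j < 3) is the j-th letter of the image of the
   k-th block of length 2; see block_action_blocks below. *)
definition block_action :: "('a list \<Rightarrow> 'a list) \<Rightarrow> (nat \<Rightarrow> 'a) \<Rightarrow> (nat \<Rightarrow> 'a)" where
  "block_action \<kappa> x =
     (\<lambda>n. \<kappa> [x (2 * (n div 3)), x (2 * (n div 3) + 1)] ! (n mod 3))"

definition kappa :: "nat list \<Rightarrow> nat list" where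
  "kappa w =
     (if w = [0, 0] then [0, 1, 0]
      else if w = [0, 1] then [0, 1, 0]
      else if w = [1, 0] then [1, 0, 1]
      else if w = [1, 1] then [1, 0, 1]
      else undefined)"

lemma block_action_blocks:
  assumes "is_block_subst_2_3 A \<kappa>" and "range x \<subseteq> A"
  shows "[block_action \<kappa> x (3 * k), block_action \<kappa> x (3 * k + 1), block_action \<kappa> x (3 * k + 2)]
         = \<kappa> [x (2 * k), x (2 * k + 1)]"
proof -
  have "length (\<kappa> [x (2 * k), x (2 * k + 1)]) = 3"
    using assms by (intro is_block_subst_2_3_def[THEN iffD1, rule_format, THEN conjunct1]) auto
  then obtain a b c where abc: "\<kappa> [x (2 * k), x (2 * k + 1)] = [a, b, c]"
    by (auto simp: numeral_3_eq_3 length_Suc_conv)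
  have "(3 * k + 1) div 3 = k" "(3 * k + 1) mod 3 = 1" "(3 * k + 2) div 3 = k" "(3 * k + 2) mod 3 = 2"
    by presburger+
  then show ?thesis
    using abc by (simp add: block_action_def)
qed

lemma is_block_subst_kappa: "is_block_subst_2_3 {0, 1} kappa"
  by (auto simp: is_block_subst_2_3_def kappa_def numeral_2_eq_2 length_Suc_conv)

lemma range_T: "range T \<subseteq> {0, 1}"
  by (auto simp: T_def)

lemma is_base32_rep_Nil: "is_base32_rep [] N \<longleftrightarrow> N = 0"
  by (simp add: is_base32_rep_def)

lemma sum_base32_Cons:
  "(\<Sum>i<length (d # ds). of_nat ((d # ds) ! i) * (3 / 2 :: rat) ^ i) =
     of_nat d + 3 / 2 * (\<Sum>i<length ds. of_nat (ds ! i) * (3 / 2) ^ i)"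
proof -
  have "(\<Sum>i<length (d # ds). of_nat ((d # ds) ! i) * (3 / 2 :: rat) ^ i) =
      of_nat d + (\<Sum>i<length ds. of_nat (ds ! i) * (3 / 2) ^ Suc i)"
    by (simp only: list.size add_0_right add_Suc_right sum.lessThan_Suc_shift) simp
  also have "(\<Sum>i<length ds. of_nat (ds ! i) * (3 / 2 :: rat) ^ Suc i) =
      3 / 2 * (\<Sum>i<length ds. of_nat (ds ! i) * (3 / 2) ^ i)"
    by (simp add: sum_distrib_left mult_ac)
  finally show ?thesis .
qed

lemma base32_sum_integral:
  "\<exists>m :: nat. 2 ^ length ds * (\<Sum>i<length ds. of_nat (ds ! i) * (3 / 2 :: rat) ^ i) = of_nat m"
proof (induction ds)
  case (Cons d ds)
  then obtain m where m:
    "2 ^ length ds * (\<Sum>i<length ds. of_nat (ds ! i) * (3 / 2 :: rat) ^ i) = of_nat m"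
    by blast
  have "2 ^ length (d # ds) * (\<Sum>i<length (d # ds). of_nat ((d # ds) ! i) * (3 / 2 :: rat) ^ i)
      = 2 * 2 ^ length ds * of_nat d
        + 3 * (2 ^ length ds * (\<Sum>i<length ds. of_nat (ds ! i) * (3 / 2 :: rat) ^ i))"
    unfolding sum_base32_Cons by (simp add: algebra_simps)
  also have "\<dots> = of_nat (2 * 2 ^ length ds * d + 3 * m)"
    unfolding m by simp
  finally show ?case by blast
qed simp

lemma is_base32_rep_Cons:
  "is_base32_rep (d # ds) N \<longleftrightarrow>
     N \<noteq> 0 \<and> d = N mod 3 \<and> is_base32_rep ds (2 * (N div 3))"
proof -
  define S where "S = (\<Sum>i<length ds. of_nat (ds ! i) * (3 / 2 :: rat) ^ i)"
  have eq: "(\<Sum>i<length (d # ds). of_nat ((d # ds) ! i) * (3 / 2 :: rat) ^ i) = of_nat d + 3 / 2 * S"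
    unfolding S_def by (rule sum_base32_Cons)
  have S_nonneg: "S \<ge> 0"
    unfolding S_def by (intro sum_nonneg) simp
  have S_pos: "S > 0" if "ds \<noteq> []" "last ds \<noteq> 0"
  proof -
    have "0 < (of_nat (ds ! (length ds - 1)) :: rat) * (3 / 2) ^ (length ds - 1)"
      using that by (simp add: last_conv_nth)
    also have "\<dots> \<le> S"
      unfolding S_def using that by (intro member_le_sum) auto
    finally show ?thesis .
  qed
  obtain m where m: "2 ^ length ds * S = (of_nat m :: rat)"
    using base32_sum_integral unfolding S_def by blast
  have digit: "d = N mod 3 \<and> S = of_nat (2 * (N div 3))"
    if d: "d \<in> {0, 1, 2}" and N: "of_nat N = of_nat d + 3 / 2 * S"
  proof -
    have "(of_nat (2 * 2 ^ length ds * N) :: rat) = of_nat (2 * 2 ^ length ds * d + 3 * m)"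
      using N m by (simp add: algebra_simps)
    then have eqn: "2 * 2 ^ length ds * N = 2 * 2 ^ length ds * d + 3 * m"
      by (simp only: of_nat_eq_iff)
    have le: "d \<le> N"
      using N S_nonneg by (simp flip: of_nat_le_iff[where 'a = rat])
    have "2 ^ Suc (length ds) * (N - d) = 3 * m"
      using eqn by (simp add: diff_mult_distrib2)
    then have "3 dvd 2 ^ Suc (length ds) * (N - d)"
      by simp
    moreover have "coprime (3 :: nat) (2 ^ Suc (length ds))"
      by (intro coprime_power_right_iff[THEN iffD2] disjI1) simp
    ultimately have "3 dvd N - d"
      by (simp add: coprime_dvd_mult_right_iff)
    then obtain q where q: "N = d + 3 * q"
      using le by (auto elim!: dvdE simp: le_imp_diff_is_add)
    have "d = N mod 3" "N div 3 = q"
      using d q by auto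
    moreover have "S = of_nat (2 * q)"
      using N q by simp
    ultimately show ?thesis by simp
  qed
  show ?thesis
  proof
    assume rep: "is_base32_rep (d # ds) N"
    then have d: "d \<in> {0, 1, 2}" and N: "of_nat N = of_nat d + 3 / 2 * S"
      and last: "last (d # ds) \<noteq> 0" and ds: "set ds \<subseteq> {0, 1, 2}"
      unfolding is_base32_rep_def eq by auto
    have "N \<noteq> 0"
    proof (cases "ds = []")
      case True
      then show ?thesis using last N S_nonneg by auto
    next
      case False
      then have "S > 0" using last S_pos by simp
      then have "(of_nat N :: rat) > 0" using N by (simp add: add_nonneg_pos)
      then show ?thesis by simp
    qed
    then show "N \<noteq> 0 \<and> d = N mod 3 \<and> is_base32_rep ds (2 * (N div 3))"
      using digit[OF d N] ds last unfolding is_base32_rep_def S_def by auto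
  next
    assume rep: "N \<noteq> 0 \<and> d = N mod 3 \<and> is_base32_rep ds (2 * (N div 3))"
    then have S: "S = of_nat (2 * (N div 3))"
      by (simp add: is_base32_rep_def S_def)
    have "(of_nat N :: rat) = of_nat (N mod 3 + 3 * (N div 3))"
      by (simp only: mod_mult_div_eq)
    then have "(of_nat N :: rat) = of_nat (N mod 3) + 3 * of_nat (N div 3)"
      by (simp only: of_nat_add of_nat_mult of_nat_numeral)
    then have "of_nat N = of_nat d + 3 / 2 * S"
      using rep by (simp add: S)
    moreover have "last (d # ds) \<noteq> 0"
    proof (cases "ds = []")
      case True
      then have "N div 3 = 0" using rep by (simp add: is_base32_rep_Nil)
      then have "N < 3" by (simp add: div_eq_0_iff)
      then show ?thesis using rep True by simp
    next
      case False
      then show ?thesis using rep by (simp add: is_base32_rep_def)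
    qed
    moreover have "N mod 3 \<in> {0, 1, 2}" by auto
    ultimately show "is_base32_rep (d # ds) N"
      using rep unfolding is_base32_rep_def eq by auto
  qed
qed

lemma ex1_base32_rep: "\<exists>!ds. is_base32_rep ds N"
proof (induction N rule: less_induct)
  case (less N)
  show ?case
  proof (cases "N = 0")
    case True
    show ?thesis
    proof (rule ex1I[of _ "[]"])
      fix ds assume "is_base32_rep ds N"
      then show "ds = []" using True by (cases ds) (auto simp: is_base32_rep_Cons)
    qed (simp add: True is_base32_rep_Nil)
  next
    case False
    then have "2 * (N div 3) < N" by presburger
    from less.IH[OF this] obtain es where es: "is_base32_rep es (2 * (N div 3))"
      and uniq: "\<And>fs. is_base32_rep fs (2 * (N div 3)) \<Longrightarrow> fs = es" by blast
    show ?thesis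
    proof (rule ex1I[of _ "N mod 3 # es"])
      fix ds assume "is_base32_rep ds N"
      then show "ds = N mod 3 # es"
        using False uniq by (cases ds) (auto simp: is_base32_rep_Cons is_base32_rep_Nil)
    qed (simp add: False es is_base32_rep_Cons)
  qed
qed

lemma is_base32_rep_base32_rep: "is_base32_rep (base32_rep N) N"
  unfolding base32_rep_def by (rule theI'[OF ex1_base32_rep])

end

theory Submission imports Defs begin

text \<open>Write N = 3k + j with j < 3. Since N = j + (3/2)(2k), the lowest digit of N is j and the
  others represent 2k, so T(N) = j + T(2k) mod 2 (\<open>T_rec\<close>). The word kappa(ab)
  alternates starting from a, so its j-th letter is j + a mod 2 (\<open>kappa_nth\<close>). With a =
  T(2k) the two agree.\<close>

lemma base32_rep_eqI: "is_base32_rep ds N \<Longrightarrow> base32_rep N = ds"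
  using ex1_base32_rep is_base32_rep_base32_rep by blast

lemma s32_rec: "s32 N = N mod 3 + s32 (2 * (N div 3))"
proof (cases "N = 0")
  \<comment> \<open>For N = 0 the representation is empty, so there is no lowest digit to split off;
    the recursion is then trivial.\<close>
  case False
  then have "base32_rep N = N mod 3 # base32_rep (2 * (N div 3))"
    by (intro base32_rep_eqI) (simp add: is_base32_rep_Cons is_base32_rep_base32_rep)
  then show ?thesis by (simp add: s32_def)
qed simp

lemma T_rec: "T N = (N mod 3 + T (2 * (N div 3))) mod 2"
  unfolding T_def by (subst s32_rec) (simp add: mod_simps)

lemma kappa_nth:
  assumes "a \<in> {0, 1}" "b \<in> {0, 1}" "j < 3"
  shows "kappa [a, b] ! j = (j + a) mod 2"
proof -
  have "j = 0 \<or> j = 1 \<or> j = 2" using assms(3) by auto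
  then show ?thesis using assms(1,2) by (auto simp: kappa_def)
qed

theorem theorem1: "block_action kappa T = T"
proof
  fix N
  have "T m \<in> {0, 1}" for m
    using range_T by blast
  \<comment> \<open>Here a = T(2k), b = T(2k + 1), with k = \<open>N div 3\<close> and j =
    \<open>N mod 3\<close>.\<close>
  then have "block_action kappa T N = (N mod 3 + T (2 * (N div 3))) mod 2"
    unfolding block_action_def by (intro kappa_nth) simp_all
  then show "block_action kappa T N = T N"
    by (simp only: T_rec[of N])
qed

end
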